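(* Let $\theta_n \in \mathbb{R}^m$, $n=1,2,\dots$, be a sequence of parameters of the exponential family $p(x;\theta)=\exp\left(\sum_{j=1}^m \theta_j T_j(x)-\psi(\theta)\right)$, $x \in \mathcal{X}$, such that for some density $q$ on $(\mathcal{X},\mu)$ we have $\lim_{n\to\infty} p(x;\theta_n)=q(x)$ for all $x\in\mathcal{X}$ (i.e. $q$ belongs to the extended exponential family). 1. If the support of $q$ is full, i.e. $\{x \in \mathcal{X} : q(x)>0\}=\mathcal{X}$, then the sequence $\theta_n$ converges and $q$ belongs to the exponential family with parameter value $\theta=\lim_{n\to\infty}\theta_n$, i.e. $q=p(\cdot;\theta)$. 2. If the support of $q$ is defective, i.e. $\{x \in \mathcal{X} : q(x)>0\}\neq\mathcal{X}$, then the sequence $\theta_n$ is not convergent in $\mathbb{R}^m$, the set $\{x \in \mathcal{X} : q(x)>0\}$ is an exposed subset of $\mathcal{X}$, and $q$ belongs to the trace of the exponential family on $\{x \in \mathcal{X} : q(x)>0\}$.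
   Context: $\mathcal{X}$ is a finite nonempty set with a reference measure $\mu$ satisfying $\mu(x)>0$ for all $x\in\mathcal{X}$. A density is a function $q:\mathcal{X}\to[0,\infty)$ with $\sum_{x\in\mathcal{X}} q(x)\mu(x)=1$. Given functions $T_1,\dots,T_m:\mathcal{X}\to\mathbb{R}$ (canonical statistics), the exponential family is the set of densities $p(x;\theta)=\exp\left(\sum_{j=1}^m\theta_jT_j(x)-\psi(\theta)\right)$, $\theta\in\mathbb{R}^m$, where $\psi(\theta)=\log\sum_{x\in\mathcal{X}}\exp\left(\sum_j\theta_jT_j(x)\right)\mu(x)$. The functions $1,T_1,\dots,T_m$ are assumed linearly independent on $\mathcal{X}$. The extended exponential family is the closure of the exponential family, in the set of all densities, for pointwise convergence on $\mathcal{X}$. Let $T=(T_1,\dots,T_m):\mathcal{X}\to\mathbb{R}^m$. The marginal polytope $M$ is the convex hull of $T(\mathcal{X})$ in $\mathbb{R}^m$. A face of $M$ is a subset $F\subset M$ for which there is an affine map $A:\mathbb{R}^m\to\mathbb{R}$ that is zero on $F$ and strictly positive on $M\setminus F$. A subset $S\subset\mathcal{X}$ is exposed (for the exponential family) if $S=T^{-1}(F)$ for some face $F$ of $M$. For a nonempty $S\subset\mathcal{X}$, the trace of the exponential family on $S$ is the exponential family on $(S,\mu_{|S})$ obtained by conditioning on $S$; a density $q$ on $\mathcal{X}$ belongs to the trace on $S$ if there is $\bar\theta\in\mathbb{R}^m$ with $q(x)=\exp\left(\sum_j\bar\theta_jT_j(x)\right)/\sum_{y\in S}\exp\left(\sum_j\bar\theta_jT_j(y)\right)\mu(y)$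 for $x\in S$ and $q(x)=0$ for $x\in\mathcal{X}\setminus S$. *)

theory Defs
  imports "HOL-Analysis.Analysis"
begin

text \<open>
  The sample space is a finite carrier set \<open>X\<close>; only the values on \<open>X\<close> of the functions
  \<open>\<mu>\<close>, \<open>q\<close>, \<open>T j\<close> matter, so equality of densities is always stated pointwise on \<open>X\<close>.
  The \<open>m\<close> canonical statistics are indexed by a finite type.
\<close>

definition prob_density :: "'a set \<Rightarrow> ('a \<Rightarrow> real) \<Rightarrow> ('a \<Rightarrow> real) \<Rightarrow> bool" where
  "prob_density X \<mu> q \<longleftrightarrow> (\<forall>x\<in>X. 0 \<le> q x) \<and> (\<Sum>x\<in>X. q x * \<mu> x) = 1"

definition log_partition ::
    "'a set \<Rightarrow> ('a \<Rightarrow> real) \<Rightarrow> ('m::finite \<Rightarrow> 'a \<Rightarrow> real) \<Rightarrow> real ^ 'm \<Rightarrow> real" where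
  "log_partition X \<mu> T \<theta> = ln (\<Sum>x\<in>X. exp (\<Sum>j\<in>UNIV. \<theta> $ j * T j x) * \<mu> x)"

definition expfam ::
    "'a set \<Rightarrow> ('a \<Rightarrow> real) \<Rightarrow> ('m::finite \<Rightarrow> 'a \<Rightarrow> real) \<Rightarrow> real ^ 'm \<Rightarrow> 'a \<Rightarrow> real" where
  "expfam X \<mu> T \<theta> x = exp ((\<Sum>j\<in>UNIV. \<theta> $ j * T j x) - log_partition X \<mu> T \<theta>)"

text \<open>
  Linear independence on \<open>X\<close> of the family \<open>1, T\<^sub>1, \<dots>, T\<^sub>m\<close>. It is a condition on a family,
  not on the set of its members: repeated statistics are dependent.
\<close>

definition one_stats_independent :: "'a set \<Rightarrow> ('m::finite \<Rightarrow> 'a \<Rightarrow> real) \<Rightarrow> bool" where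
  "one_stats_independent X T \<longleftrightarrow>
     (\<forall>c0 c. (\<forall>x\<in>X. c0 * 1 + (\<Sum>j\<in>UNIV. c j * T j x) = 0) \<longrightarrow> c0 = 0 \<and> (\<forall>j. c j = 0))"

definition stat_vec :: "('m::finite \<Rightarrow> 'a \<Rightarrow> real) \<Rightarrow> 'a \<Rightarrow> real ^ 'm" where
  "stat_vec T x = (\<chi> j. T j x)"

definition marginal_polytope :: "'a set \<Rightarrow> ('m::finite \<Rightarrow> 'a \<Rightarrow> real) \<Rightarrow> (real ^ 'm) set" where
  "marginal_polytope X T = convex hull (stat_vec T ` X)"

definition affine_map :: "(real ^ 'm \<Rightarrow> real) \<Rightarrow> bool" where
  "affine_map A \<longleftrightarrow> (\<exists>L c. linear L \<and> A = (\<lambda>t. L t + c))"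

text \<open>
  Faces in the sense of a supporting affine map. The empty set (\<open>A = 1\<close>) and \<open>M\<close> itself
  (\<open>A = 0\<close>) are faces.
\<close>

definition polytope_face :: "(real ^ 'm) set \<Rightarrow> (real ^ 'm) set \<Rightarrow> bool" where
  "polytope_face F M \<longleftrightarrow>
     F \<subseteq> M \<and> (\<exists>A. affine_map A \<and> (\<forall>t\<in>F. A t = 0) \<and> (\<forall>t\<in>M - F. 0 < A t))"

definition exposed_subset :: "'a set \<Rightarrow> ('m::finite \<Rightarrow> 'a \<Rightarrow> real) \<Rightarrow> 'a set \<Rightarrow> bool" where
  "exposed_subset X T S \<longleftrightarrow>
     (\<exists>F. polytope_face F (marginal_polytope X T) \<and> S = {x \<in> X. stat_vec T x \<in> F})"

definition in_trace ::
    "'a set \<Rightarrow> ('a \<Rightarrow> real) \<Rightarrow> ('m::finite \<Rightarrow> 'a \<Rightarrow> real) \<Rightarrow> 'a set \<Rightarrow> ('a \<Rightarrow> real) \<Rightarrow> bool" where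
  "in_trace X \<mu> T S q \<longleftrightarrow>
     S \<noteq> {} \<and> S \<subseteq> X \<and> prob_density X \<mu> q \<and>
     (\<exists>\<theta> :: real ^ 'm.
        (\<forall>x\<in>S. q x = exp (\<Sum>j\<in>UNIV. \<theta> $ j * T j x)
                    / (\<Sum>y\<in>S. exp (\<Sum>j\<in>UNIV. \<theta> $ j * T j y) * \<mu> y)) \<and>
        (\<forall>x\<in>X - S. q x = 0))"

end

theory Submission
  imports Defs
begin

text \<open>
  Fix a point \<open>a\<close> of the support \<open>S\<close> of \<open>q\<close>. Dividing by the density at \<open>a\<close> removes the normalizing
  constant: \<open>p(x;\<theta>) / p(a;\<theta>) = exp (\<theta> \<bullet> (T x - T a))\<close>. Hence the numbers \<open>\<theta>\<^sub>n \<bullet> u\<close> converge for every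
  \<open>u = T x - T a\<close> with \<open>x \<in> S\<close>, and so the orthogonal projection \<open>\<xi>\<^sub>n\<close> of \<open>\<theta>\<^sub>n\<close> to the span \<open>V\<close> of these
  vectors converges to some \<open>c\<close> (lemma \<open>convergent_component\<close>).

  If \<open>S\<close> is everything, independence of \<open>1, T\<^sub>1, \<dots>, T\<^sub>m\<close> says that \<open>V\<close> is the whole parameter space, so
  \<open>\<xi>\<^sub>n = \<theta>\<^sub>n\<close> converges, and continuity of \<open>p(x;\<theta>)\<close> in \<open>\<theta>\<close> identifies \<open>q\<close>.

  If \<open>S\<close> is not everything, \<open>\<theta>\<^sub>n\<close> cannot converge, because by continuity \<open>q\<close> would then be a strictly
  positive member of the family. On \<open>S\<close> the ratios \<open>q x / q a = exp (c \<bullet> (T x - T a))\<close> show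
  that \<open>c\<close> is a parameter for \<open>q\<close> in the trace on \<open>S\<close>. For exposedness, consider the remaining component
  \<open>w\<^sub>n = \<theta>\<^sub>n - \<xi>\<^sub>n\<close>. It is orthogonal to \<open>V\<close>, so \<open>w\<^sub>n \<bullet> (T x - T a) = 0\<close> on \<open>S\<close> for every \<open>n\<close>; off \<open>S\<close>
  the ratios tend to \<open>0\<close> while the factor \<open>exp (\<xi>\<^sub>n \<bullet> (T x - T a))\<close> has a positive limit, so
  \<open>w\<^sub>n \<bullet> (T x - T a) < 0\<close> for all large \<open>n\<close>. A single such \<open>w\<^sub>n\<close> is the normal of a hyperplane that
  exposes \<open>S\<close>.
\<close>

text \<open>
  The sequence \<open>\<xi>\<close> is the orthogonal projection of \<open>\<theta>\<close> to the span of \<open>U\<close>: its coordinates in an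
  orthonormal basis of the span are linear combinations of the convergent \<open>\<theta> n \<bullet> u\<close>. The part
  \<open>\<theta> n - \<xi> n\<close>, which is orthogonal to \<open>U\<close>, may diverge.
\<close>

lemma convergent_component:
  fixes \<theta> :: "nat \<Rightarrow> 'e::euclidean_space" and U :: "'e set"
  assumes conv: "\<And>u. u \<in> U \<Longrightarrow> convergent (\<lambda>n. \<theta> n \<bullet> u)"
  obtains \<xi> c where "\<xi> \<longlonglongrightarrow> c" and "\<And>n u. u \<in> U \<Longrightarrow> \<xi> n \<bullet> u = \<theta> n \<bullet> u"
proof -
  have conv_span: "convergent (\<lambda>n. \<theta> n \<bullet> v)" if "v \<in> span U" for v
    using that
  proof (induction rule: span_induct_alt)
    case base
    then show ?case by (simp add: convergent_const)
  next
    case (step r u v)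
    have "convergent (\<lambda>n. r * (\<theta> n \<bullet> u) + \<theta> n \<bullet> v)"
      using step conv by (intro convergent_add convergent_mult convergent_const)
    then show ?case by (simp add: inner_add_right)
  qed
  obtain B where B: "B \<subseteq> span U" "pairwise orthogonal B" "\<And>b. b \<in> B \<Longrightarrow> norm b = 1"
      "independent B" "span B = span U"
    using orthonormal_basis_subspace[OF subspace_span] by metis
  have finB: "finite B" using B(4) by (rule independent_imp_finite)
  define \<xi> where "\<xi> n = (\<Sum>b\<in>B. (\<theta> n \<bullet> b) *\<^sub>R b)" for n
  define c where "c = (\<Sum>b\<in>B. lim (\<lambda>n. \<theta> n \<bullet> b) *\<^sub>R b)"
  have lim: "\<xi> \<longlonglongrightarrow> c"
    unfolding \<xi>_def c_def
    using conv_span B(1) by (intro tendsto_intros) (auto simp: convergent_LIMSEQ_iff)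
  have basis: "\<xi> n \<bullet> b = \<theta> n \<bullet> b" if b: "b \<in> B" for n b
  proof -
    have "\<xi> n \<bullet> b = (\<Sum>b'\<in>B. if b' = b then \<theta> n \<bullet> b else 0)"
      unfolding \<xi>_def inner_sum_left
    proof (intro sum.cong refl)
      fix b' assume "b' \<in> B"
      then show "((\<theta> n \<bullet> b') *\<^sub>R b') \<bullet> b = (if b' = b then \<theta> n \<bullet> b else 0)"
        using B(2) B(3)[OF b] b by (auto simp: pairwise_def orthogonal_def norm_eq_1)
    qed
    then show ?thesis using b finB by simp
  qed
  have "\<xi> n \<bullet> u = \<theta> n \<bullet> u" if "u \<in> U" for n u
  proof -
    have "u \<in> span B" using that B(5) by (simp add: span_base)
    then have "(\<xi> n - \<theta> n) \<bullet> u = 0"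
      by (induction rule: span_induct_alt) (simp_all add: inner_add_right inner_diff_left basis)
    then show ?thesis by (simp add: inner_diff_left)
  qed
  with lim show thesis by (rule that)
qed

lemma sum_stats_eq_inner: "(\<Sum>j\<in>UNIV. \<theta> $ j * T j x) = \<theta> \<bullet> stat_vec T x"
  by (simp add: inner_vec_def stat_vec_def)

lemma expfam_pos: "0 < expfam X \<mu> T \<theta> x"
  by (simp add: expfam_def)

lemma expfam_ratio:
  "expfam X \<mu> T \<theta> x / expfam X \<mu> T \<theta> a = exp (\<theta> \<bullet> (stat_vec T x - stat_vec T a))"
  by (simp add: expfam_def sum_stats_eq_inner exp_diff inner_diff_right)

lemma tendsto_expfam:
  assumes "finite X" "X \<noteq> {}" "\<forall>x\<in>X. 0 < \<mu> x" "\<theta> \<longlonglongrightarrow> c"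
  shows "(\<lambda>n. expfam X \<mu> T (\<theta> n) x) \<longlonglongrightarrow> expfam X \<mu> T c x"
proof -
  have "0 < (\<Sum>x\<in>X. exp (c \<bullet> stat_vec T x) * \<mu> x)"
    using assms(1-3) by (intro sum_pos) auto
  then show ?thesis
    unfolding expfam_def log_partition_def sum_stats_eq_inner
    using assms(4) by (intro tendsto_intros) auto
qed

text \<open>
  Independence of \<open>1, T\<^sub>1, \<dots>, T\<^sub>m\<close> means that \<open>T\<close> maps \<open>X\<close> into no hyperplane.
\<close>

lemma stats_differences_total:
  assumes "one_stats_independent X T"
    and orth: "\<And>x. x \<in> X \<Longrightarrow> w \<bullet> (stat_vec T x - stat_vec T a) = 0"
  shows "w = 0"
proof -
  have "\<forall>x\<in>X. - (w \<bullet> stat_vec T a) * 1 + (\<Sum>j\<in>UNIV. w $ j * T j x) = 0"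
    using orth by (simp add: sum_stats_eq_inner inner_diff_right)
  then have "\<forall>j. w $ j = 0"
    using assms(1) unfolding one_stats_independent_def by blast
  then show ?thesis by (simp add: vec_eq_iff)
qed

lemma exposed_subset_if_supporting:
  assumes "S \<subseteq> X"
    and on: "\<And>x. x \<in> S \<Longrightarrow> w \<bullet> (stat_vec T x - t) = 0"
    and off: "\<And>x. x \<in> X - S \<Longrightarrow> w \<bullet> (stat_vec T x - t) < 0"
  shows "exposed_subset X T S"
proof -
  let ?M = "marginal_polytope X T"
  define F where "F = {s \<in> ?M. w \<bullet> (s - t) = 0}"
  have "stat_vec T ` X \<subseteq> {s. w \<bullet> s \<le> w \<bullet> t}"
    using on off by (force simp: inner_diff_right)
  then have "?M \<subseteq> {s. w \<bullet> s \<le> w \<bullet> t}"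
    unfolding marginal_polytope_def by (intro hull_minimal convex_halfspace_le)
  then have nonpos: "w \<bullet> (s - t) \<le> 0" if "s \<in> ?M" for s
    using that by (auto simp: inner_diff_right)
  have "linear (\<lambda>s. (- w) \<bullet> s)"
    by (rule bounded_linear.linear[OF bounded_linear_inner_right])
  then have "affine_map (\<lambda>s. (- w) \<bullet> s + w \<bullet> t)"
    unfolding affine_map_def by blast
  moreover have "\<forall>s\<in>F. (- w) \<bullet> s + w \<bullet> t = 0"
    by (simp add: F_def inner_diff_right)
  moreover have "\<forall>s\<in>?M - F. 0 < (- w) \<bullet> s + w \<bullet> t"
    using nonpos by (force simp: F_def inner_diff_right)
  ultimately have "polytope_face F ?M"
    unfolding polytope_face_def F_def by blast
  moreover have "S = {x \<in> X. stat_vec T x \<in> F}"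
  proof -
    have "stat_vec T x \<in> ?M" if "x \<in> X" for x
      using that by (simp add: marginal_polytope_def hull_inc)
    then show ?thesis
      using assms(1) on off by (force simp: F_def)
  qed
  ultimately show ?thesis unfolding exposed_subset_def by blast
qed

text \<open>
  Up to the normalization, which is forced by total mass one, membership in a trace is a statement
  about the ratios of \<open>q\<close> to its value at one point.
\<close>

lemma in_trace_if_ratio:
  assumes "finite X" and dens: "prob_density X \<mu> q"
    and "a \<in> S" "S \<subseteq> X"
    and zero: "\<And>x. x \<in> X - S \<Longrightarrow> q x = 0"
    and ratio: "\<And>x. x \<in> S \<Longrightarrow> q x = q a * exp (c \<bullet> (stat_vec T x - stat_vec T a))"
  shows "in_trace X \<mu> T S q"
proof -
  define Z where "Z = (\<Sum>y\<in>S. exp (c \<bullet> stat_vec T y) * \<mu> y)"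
  define k where "k = q a / exp (c \<bullet> stat_vec T a)"
  have q_eq: "q x = k * exp (c \<bullet> stat_vec T x)" if "x \<in> S" for x
    using ratio[OF that] by (simp add: k_def inner_diff_right exp_diff)
  have "1 = (\<Sum>x\<in>X. q x * \<mu> x)" using dens by (simp add: prob_density_def)
  also have "\<dots> = (\<Sum>x\<in>S. q x * \<mu> x)"
    using assms(1,4) zero by (intro sum.mono_neutral_right) auto
  also have "\<dots> = k * Z"
    unfolding Z_def sum_distrib_left by (intro sum.cong) (simp_all add: q_eq)
  finally have "1 = k * Z" .
  then have "k = 1 / Z" by (metis mult_zero_right nonzero_eq_divide_eq zero_neq_one)
  then have "\<forall>x\<in>S. q x = exp (c \<bullet> stat_vec T x) / Z"
    by (simp add: q_eq)
  then show ?thesis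
    unfolding in_trace_def sum_stats_eq_inner Z_def using assms zero by blast
qed

theorem theorem1:
  fixes X :: "'a set"
    and \<mu> :: "'a \<Rightarrow> real"
    and T :: "'m::finite \<Rightarrow> 'a \<Rightarrow> real"
    and \<theta> :: "nat \<Rightarrow> real ^ 'm"
    and q :: "'a \<Rightarrow> real"
  assumes "finite X" and "X \<noteq> {}"
    and "\<forall>x\<in>X. 0 < \<mu> x"
    and "one_stats_independent X T"
    and "prob_density X \<mu> q"
    and "\<forall>x\<in>X. (\<lambda>n. expfam X \<mu> T (\<theta> n) x) \<longlonglongrightarrow> q x"
  shows "({x \<in> X. 0 < q x} = X \<longrightarrow>
            convergent \<theta> \<and> (\<forall>x\<in>X. q x = expfam X \<mu> T (lim \<theta>) x)) \<and>
         ({x \<in> X. 0 < q x} \<noteq> X \<longrightarrow>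
            \<not> convergent \<theta> \<and>
            exposed_subset X T {x \<in> X. 0 < q x} \<and>
            in_trace X \<mu> T {x \<in> X. 0 < q x} q)"
proof -
  define S where "S = {x \<in> X. 0 < q x}"
  have S_sub: "S \<subseteq> X" by (auto simp: S_def)
  have q_zero: "q x = 0" if "x \<in> X - S" for x
    using that assms(5) by (force simp: S_def prob_density_def)
  have "S \<noteq> {}"
  proof
    assume "S = {}"
    then have "(\<Sum>x\<in>X. q x * \<mu> x) = 0" using q_zero by simp
    then show False using assms(5) by (simp add: prob_density_def)
  qed
  then obtain a where a: "a \<in> S" by blast
  then have "a \<in> X" and qa: "0 < q a" by (auto simp: S_def)
  define u where "u x = stat_vec T x - stat_vec T a" for x
  have ratio_lim: "(\<lambda>n. exp (\<theta> n \<bullet> u x)) \<longlonglongrightarrow> q x / q a" if "x \<in> X" for x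
  proof -
    have "(\<lambda>n. expfam X \<mu> T (\<theta> n) x / expfam X \<mu> T (\<theta> n) a) \<longlonglongrightarrow> q x / q a"
      using assms(6) that \<open>a \<in> X\<close> qa by (intro tendsto_divide) auto
    then show ?thesis by (simp add: expfam_ratio u_def)
  qed
  have "convergent (\<lambda>n. \<theta> n \<bullet> u x)" if "x \<in> S" for x
  proof -
    have "(\<lambda>n. ln (exp (\<theta> n \<bullet> u x))) \<longlonglongrightarrow> ln (q x / q a)"
      using that S_sub qa by (intro tendsto_ln ratio_lim) (auto simp: S_def)
    then show ?thesis by (auto simp: convergent_def)
  qed
  then obtain \<xi> c where \<xi>: "\<xi> \<longlonglongrightarrow> c" and "\<And>n v. v \<in> u ` S \<Longrightarrow> \<xi> n \<bullet> v = \<theta> n \<bullet> v"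
    using convergent_component[of "u ` S" \<theta>] by blast
  then have \<xi>_eq: "\<xi> n \<bullet> u x = \<theta> n \<bullet> u x" if "x \<in> S" for n x
    using that by blast
  have \<xi>_lim: "(\<lambda>n. exp (\<xi> n \<bullet> u x)) \<longlonglongrightarrow> exp (c \<bullet> u x)" for x
    using \<xi> by (intro tendsto_intros)
  have q_eq: "q x = expfam X \<mu> T d x" if "\<theta> \<longlonglongrightarrow> d" "x \<in> X" for x d
    using LIMSEQ_unique assms(6) tendsto_expfam[OF assms(1-3) that(1)] that(2) by blast
  show ?thesis
    unfolding S_def[symmetric]
  proof (intro conjI impI)
    assume full: "S = X"
    have "\<theta> n - \<xi> n = 0" for n
      using \<xi>_eq full
      by (intro stats_differences_total[OF assms(4), where a = a])
        (simp add: inner_diff_left flip: u_def)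
    then have "\<theta> = \<xi>" by (simp add: fun_eq_iff)
    then show "convergent \<theta>" using \<xi> by (auto simp: convergent_def)
    then show "\<forall>x\<in>X. q x = expfam X \<mu> T (lim \<theta>) x"
      using q_eq by (simp add: convergent_LIMSEQ_iff)
  next
    assume "S \<noteq> X"
    then obtain b where "b \<in> X - S" using S_sub by blast
    then show "\<not> convergent \<theta>"
      using q_eq q_zero expfam_pos by (metis DiffD1 convergent_def less_irrefl)
  next
    have "\<forall>\<^sub>F n in sequentially. (\<theta> n - \<xi> n) \<bullet> u x < 0" if x: "x \<in> X - S" for x
    proof -
      have "(\<lambda>n. exp (\<theta> n \<bullet> u x) / exp (\<xi> n \<bullet> u x)) \<longlonglongrightarrow> (q x / q a) / exp (c \<bullet> u x)"
        using x by (intro tendsto_divide ratio_lim \<xi>_lim) auto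
      then have "(\<lambda>n. exp ((\<theta> n - \<xi> n) \<bullet> u x)) \<longlonglongrightarrow> 0"
        using q_zero[OF x] by (simp add: inner_diff_left exp_diff)
      then have "\<forall>\<^sub>F n in sequentially. exp ((\<theta> n - \<xi> n) \<bullet> u x) < 1"
        by (rule order_tendstoD) simp
      then show ?thesis by simp
    qed
    then have "\<forall>\<^sub>F n in sequentially. \<forall>x\<in>X - S. (\<theta> n - \<xi> n) \<bullet> u x < 0"
      using assms(1) by (intro eventually_ball_finite) auto
    then obtain n where "\<forall>x\<in>X - S. (\<theta> n - \<xi> n) \<bullet> u x < 0"
      by (auto simp: eventually_sequentially)
    moreover have "\<forall>x\<in>S. (\<theta> n - \<xi> n) \<bullet> u x = 0"
      using \<xi>_eq by (simp add: inner_diff_left)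
    ultimately show "exposed_subset X T S"
      using S_sub unfolding u_def by (intro exposed_subset_if_supporting) auto
  next
    have "q x = q a * exp (c \<bullet> u x)" if "x \<in> S" for x
    proof -
      have "q x / q a = exp (c \<bullet> u x)"
        using LIMSEQ_unique ratio_lim \<xi>_lim[of x] \<xi>_eq[OF that] that S_sub
        by (metis (no_types, lifting) subsetD ext)
      then show ?thesis using qa by (simp add: field_simps)
    qed
    then show "in_trace X \<mu> T S q"
      using a S_sub q_zero unfolding u_def by (intro in_trace_if_ratio[OF assms(1,5)])
  qed
qed

end
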